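(* Given a Lipschitz function $A^*:\Omega\to\mathbb{R}$ (of the variable $y$), there exist a Lipschitz function $A:\Omega\to\mathbb{R}$ (of the variable $x$) and a Lipschitz function $W:\Omega\times\Omega\to\mathbb{R}$, such that for all $i=1,\dots,r$ and all $x,y\in\Omega$ $$A(ix)+W(ix,y)=A^*(\tau_i(y))+W(x,\tau_i(y)).$$ Similarly, given a Lipschitz function $A:\Omega\to\mathbb{R}$ one can find a Lipschitz function $A^*:\Omega\to\mathbb{R}$ and a Lipschitz function $W:\Omega\times\Omega\to\mathbb{R}$ such that the same identity holds for all $i,x,y$.
   Context: $\mathcal{A}=\{1,\dots,r\}$, $\Omega=\mathcal{A}^{\mathbb{N}}$ with metric $d(x,y)=2^{-\min\{j\ge1:\,x_j\neq y_j\}}$ for $x\ne y$, $d(x,x)=0$; $\Omega\times\Omega$ carries the maximum metric. $ix=(i,x_1,x_2,\dots)$. Let $\phi:\mathcal{A}\times\mathcal{A}\to\mathcal{A}$ be such that $b\mapsto\phi(a,b)$ is bijective for every fixed $a$, and $\Phi:\Omega\to\Omega$, $\Phi(x_1,x_2,x_3,\dots)=(\phi(x_1,x_2),\phi(x_2,x_3),\dots)$. For $j\in\mathcal{A}$, $\tau_j(x)$ is the unique $y\in\Omega$ with $\Phi(y)=x$ and $y_1=j$. *)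

theory Defs
  imports "HOL-Analysis.Analysis" "HOL-Library.Stream"
begin

(* A sequence (x_1, x_2, ...) is a stream x with x_j = x !! (j - 1), so that the
   concatenation ix is i ## x. *)
definition Omega :: "nat \<Rightarrow> nat stream set" where
  "Omega r = streams {1..r}"

(* Since x !! n is x_(n+1), the least j \<ge> 1 with x_j \<noteq> y_j is the successor of the
   least n with x !! n \<noteq> y !! n. *)
definition seq_dist :: "nat stream \<Rightarrow> nat stream \<Rightarrow> real" where
  "seq_dist x y = (if x = y then 0 else (1 / 2) ^ Suc (LEAST n. x !! n \<noteq> y !! n))"

definition Omega_metric :: "nat \<Rightarrow> nat stream metric" where
  "Omega_metric r = metric (Omega r, seq_dist)"

(* The library's prod_metric is the Euclidean combination, not the maximum. *)
definition max_metric :: "'a metric \<Rightarrow> 'b metric \<Rightarrow> ('a \<times> 'b) metric" where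
  "max_metric m1 m2 = metric (mspace m1 \<times> mspace m2,
     \<lambda>p q. max (mdist m1 (fst p) (fst q)) (mdist m2 (snd p) (snd q)))"

definition Phi :: "(nat \<Rightarrow> nat \<Rightarrow> nat) \<Rightarrow> nat stream \<Rightarrow> nat stream" where
  "Phi \<phi> x = smap2 \<phi> x (stl x)"

definition tau :: "nat \<Rightarrow> (nat \<Rightarrow> nat \<Rightarrow> nat) \<Rightarrow> nat \<Rightarrow> nat stream \<Rightarrow> nat stream" where
  "tau r \<phi> j x = (THE y. y \<in> Omega r \<and> Phi \<phi> y = x \<and> shd y = j)"

lemma stream_eq_iff_snth: "x = y \<longleftrightarrow> (\<forall>n. x !! n = y !! n)"
proof
  assume "\<forall>n. x !! n = y !! n"
  then have "smap (snth x) nats = smap (snth y) nats"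
    by (intro stream.map_cong) auto
  then show "x = y"
    by (simp flip: stream_smap_nats)
qed simp

lemma seq_dist_le_pow:
  assumes "\<And>k. k < n \<Longrightarrow> x !! k = y !! k"
  shows "seq_dist x y \<le> (1 / 2) ^ Suc n"
proof (cases "x = y")
  case False
  then have "\<exists>k. x !! k \<noteq> y !! k"
    by (simp add: stream_eq_iff_snth)
  then have "x !! (LEAST k. x !! k \<noteq> y !! k) \<noteq> y !! (LEAST k. x !! k \<noteq> y !! k)"
    by (rule LeastI_ex)
  then have "n \<le> (LEAST k. x !! k \<noteq> y !! k)"
    using assms not_less by blast
  then have "(1 / 2 :: real) ^ Suc (LEAST k. x !! k \<noteq> y !! k) \<le> (1 / 2) ^ Suc n"
    by (intro power_decreasing) auto
  with False show ?thesis
    by (simp only: seq_dist_def if_False)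
qed (simp add: seq_dist_def)

lemma seq_dist_ultra: "seq_dist x z \<le> max (seq_dist x y) (seq_dist y z)"
proof (cases "x = y \<or> y = z")
  case True
  then show ?thesis
    by (auto simp: seq_dist_def)
next
  case False
  define a where "a = (LEAST n. x !! n \<noteq> y !! n)"
  define b where "b = (LEAST n. y !! n \<noteq> z !! n)"
  have "x !! k = z !! k" if "k < min a b" for k
    using that not_less_Least[of k "\<lambda>n. x !! n \<noteq> y !! n"]
      not_less_Least[of k "\<lambda>n. y !! n \<noteq> z !! n"]
    by (auto simp: a_def b_def)
  then have "seq_dist x z \<le> (1 / 2) ^ Suc (min a b)"
    by (rule seq_dist_le_pow)
  also have "\<dots> \<le> max ((1 / 2) ^ Suc a) ((1 / 2) ^ Suc b)"
    by (auto simp: min_def)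
  also have "\<dots> = max (seq_dist x y) (seq_dist y z)"
    using False by (simp add: seq_dist_def a_def b_def)
  finally show ?thesis .
qed

lemma seq_dist_nonneg: "0 \<le> seq_dist x y"
  by (simp add: seq_dist_def)

lemma Metric_space_seq_dist: "Metric_space M seq_dist"
proof
  fix x y z :: "nat stream"
  show "0 \<le> seq_dist x y"
    by (rule seq_dist_nonneg)
  show "seq_dist x y = seq_dist y x"
    by (simp add: seq_dist_def eq_commute)
  show "seq_dist x y = 0 \<longleftrightarrow> x = y"
    by (simp add: seq_dist_def)
  show "seq_dist x z \<le> seq_dist x y + seq_dist y z"
    using seq_dist_ultra[of x z y] seq_dist_nonneg[of x y] seq_dist_nonneg[of y z]
    by linarith
qed

lemma mspace_Omega_metric [simp]: "mspace (Omega_metric r) = Omega r"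
  by (simp add: Omega_metric_def Metric_space.mspace_metric Metric_space_seq_dist)

lemma mdist_Omega_metric [simp]: "mdist (Omega_metric r) = seq_dist"
  by (simp add: Omega_metric_def Metric_space.mdist_metric Metric_space_seq_dist)

lemma Metric_space_max_metric:
  "Metric_space (mspace m1 \<times> mspace m2)
     (\<lambda>p q. max (mdist m1 (fst p) (fst q)) (mdist m2 (snd p) (snd q)))"
proof
  fix p q s
  assume p: "p \<in> mspace m1 \<times> mspace m2" and q: "q \<in> mspace m1 \<times> mspace m2"
  have "max (mdist m1 (fst p) (fst q)) (mdist m2 (snd p) (snd q)) = 0 \<longleftrightarrow>
    mdist m1 (fst p) (fst q) = 0 \<and> mdist m2 (snd p) (snd q) = 0"
    using mdist_nonneg[of m1 "fst p" "fst q"] mdist_nonneg[of m2 "snd p" "snd q"]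
    by linarith
  with p q show "max (mdist m1 (fst p) (fst q)) (mdist m2 (snd p) (snd q)) = 0 \<longleftrightarrow> p = q"
    by (auto simp: prod_eq_iff)
  assume "s \<in> mspace m1 \<times> mspace m2"
  with p q have "mdist m1 (fst p) (fst s) \<le> mdist m1 (fst p) (fst q) + mdist m1 (fst q) (fst s)"
    "mdist m2 (snd p) (snd s) \<le> mdist m2 (snd p) (snd q) + mdist m2 (snd q) (snd s)"
    by (auto intro!: mdist_triangle)
  then show "max (mdist m1 (fst p) (fst s)) (mdist m2 (snd p) (snd s)) \<le>
    max (mdist m1 (fst p) (fst q)) (mdist m2 (snd p) (snd q)) +
    max (mdist m1 (fst q) (fst s)) (mdist m2 (snd q) (snd s))"
    by linarith
qed (auto simp: mdist_commute le_max_iff_disj)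

lemma mspace_max_metric [simp]: "mspace (max_metric m1 m2) = mspace m1 \<times> mspace m2"
  by (simp add: max_metric_def Metric_space.mspace_metric Metric_space_max_metric)

lemma mdist_max_metric [simp]:
  "mdist (max_metric m1 m2) p q = max (mdist m1 (fst p) (fst q)) (mdist m2 (snd p) (snd q))"
  by (simp add: max_metric_def Metric_space.mdist_metric Metric_space_max_metric)

lemma snth_Phi: "Phi \<phi> y !! n = \<phi> (y !! n) (y !! Suc n)"
  by (simp add: Phi_def smap2_szip)

lemma tau_ex1:
  assumes bij: "\<forall>a\<in>{1..r}. bij_betw (\<phi> a) {1..r} {1..r}"
    and j: "j \<in> {1..r}" and x: "x \<in> Omega r"
  shows "\<exists>!y. y \<in> Omega r \<and> Phi \<phi> y = x \<and> shd y = j"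
proof (rule ex_ex1I)
  define g where "g = rec_nat j (\<lambda>n a. inv_into {1..r} (\<phi> a) (x !! n))"
  have g0: "g 0 = j" and gS: "g (Suc n) = inv_into {1..r} (\<phi> (g n)) (x !! n)" for n
    by (simp_all add: g_def)
  have xn: "x !! n \<in> {1..r}" for n
    using x unfolding Omega_def by (rule snth_in)
  have gn: "g n \<in> {1..r}" for n
  proof (induction n)
    case 0
    then show ?case using j by (simp only: g0)
  next
    case (Suc n)
    then have "x !! n \<in> \<phi> (g n) ` {1..r}"
      using bij xn bij_betw_imp_surj_on by blast
    then show ?case unfolding gS by (rule inv_into_into)
  qed
  have "\<phi> (g n) (g (Suc n)) = x !! n" for n
    unfolding gS using bij gn xn by (blast intro: bij_betw_inv_into_right)
  then have "Phi \<phi> (smap g nats) = x"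
    by (simp add: stream_eq_iff_snth snth_Phi)
  moreover have "smap g nats \<in> Omega r"
    using gn by (simp add: Omega_def streams_iff_snth)
  moreover have "shd (smap g nats) = j"
    by (simp add: g0)
  ultimately show "\<exists>y. y \<in> Omega r \<and> Phi \<phi> y = x \<and> shd y = j"
    by blast
next
  fix y z
  assume y: "y \<in> Omega r \<and> Phi \<phi> y = x \<and> shd y = j"
    and z: "z \<in> Omega r \<and> Phi \<phi> z = x \<and> shd z = j"
  have yn: "y !! n \<in> {1..r}" and zn: "z !! n \<in> {1..r}" for n
    using y z unfolding Omega_def by (blast intro: snth_in)+
  have "y !! n = z !! n" for n
  proof (induction n)
    case 0
    then show ?case using y z by simp
  next
    case (Suc n)
    have "\<phi> (y !! n) (y !! Suc n) = \<phi> (y !! n) (z !! Suc n)"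
      using y z Suc by (metis snth_Phi)
    moreover have "inj_on (\<phi> (y !! n)) {1..r}"
      using bij yn bij_betw_imp_inj_on by blast
    ultimately show ?case
      using yn zn by (blast dest: inj_onD)
  qed
  then show "y = z"
    by (simp add: stream_eq_iff_snth)
qed

end

theory Submission
  imports Defs
begin

text \<open>
  The map \<open>(ix, y) \<mapsto> (x, \<tau>\<^sub>i y)\<close> is an invertible skew product, expanding in one coordinate and
  contracting in the other, and so is its inverse \<open>(x, z) \<mapsto> (z\<^sub>1 x, \<Phi> z)\<close>. For a skew product
  \<open>F (x, y) = (T x, \<kappa>\<^sub>i y)\<close> with \<open>i = x\<^sub>1\<close>, a function \<open>f\<close> of the contracted coordinate is made, up to a
  coboundary, a function of the expanded one by Sinai's device: compare the orbit of \<open>(x, y)\<close> with that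
  of \<open>(x, y\<^sub>0)\<close> for a fixed \<open>y\<^sub>0\<close> and sum the differences of \<open>f\<close> along the two. The series converges
  geometrically, as the second coordinates approach each other. The two parts of the theorem are
  this statement for the map and for its inverse.
\<close>

section \<open>Lipschitz conditions expressed through common prefixes\<close>

lemma stake_eq_iff_snth: "stake n x = stake n y \<longleftrightarrow> (\<forall>k<n. x !! k = y !! k)"
  by (simp add: list_eq_iff_nth_eq)

lemma seq_dist_eq_pow:
  assumes "x \<noteq> y"
  obtains n where "seq_dist x y = (1 / 2) ^ Suc n"
  using assms by (simp add: seq_dist_def)

text \<open>A first disagreement at index \<open>n\<close>, counted from 0, gives distance
  \<open>(1 / 2) ^ Suc n\<close>; hence the exponent is one more than the number of agreeing
  symbols.\<close>

lemma stake_eq_iff_seq_dist: "stake n x = stake n y \<longleftrightarrow> seq_dist x y \<le> (1 / 2) ^ Suc n"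
proof
  assume "stake n x = stake n y"
  then show "seq_dist x y \<le> (1 / 2) ^ Suc n"
    by (intro seq_dist_le_pow) (simp add: stake_eq_iff_snth)
next
  assume le: "seq_dist x y \<le> (1 / 2) ^ Suc n"
  show "stake n x = stake n y"
  proof (cases "x = y")
    case False
    then have "(1 / 2 :: real) ^ Suc (LEAST k. x !! k \<noteq> y !! k) \<le> (1 / 2) ^ Suc n"
      using le by (simp only: seq_dist_def if_False)
    then have "n \<le> (LEAST k. x !! k \<noteq> y !! k)"
      by (simp add: power_decreasing_iff del: power_Suc)
    then show ?thesis
      using not_less_Least[of _ "\<lambda>k. x !! k \<noteq> y !! k"]
      by (force simp: stake_eq_iff_snth)
  qed simp
qed

text \<open>Nonzero distances are powers of 1/2, so being Lipschitz means that the variation over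
  sequences with a common prefix decays geometrically in its length. Orbit estimates then reduce to
  counting agreeing symbols.\<close>

lemma Lipschitz_Omega_iff:
  fixes f :: "nat stream \<Rightarrow> real"
  shows "Lipschitz_continuous_map (Omega_metric r) euclidean_metric f \<longleftrightarrow>
    (\<exists>L\<ge>0. \<forall>x\<in>Omega r. \<forall>y\<in>Omega r. \<forall>n. stake n x = stake n y \<longrightarrow> \<bar>f x - f y\<bar> \<le> L * (1 / 2) ^ n)"
    (is "?lhs \<longleftrightarrow> ?rhs")
proof
  assume ?lhs
  then obtain B where B: "B > 0"
    "\<And>x y. x \<in> Omega r \<Longrightarrow> y \<in> Omega r \<Longrightarrow> \<bar>f x - f y\<bar> \<le> B * seq_dist x y"
    by (auto simp: Lipschitz_continuous_map_pos dist_real_def)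
  have "\<bar>f x - f y\<bar> \<le> B * (1 / 2) ^ n"
    if "x \<in> Omega r" "y \<in> Omega r" "stake n x = stake n y" for x y n
  proof -
    have "seq_dist x y \<le> (1 / 2) ^ Suc n"
      using that by (simp only: stake_eq_iff_seq_dist)
    also have "\<dots> \<le> (1 / 2) ^ n"
      by simp
    finally have "B * seq_dist x y \<le> B * (1 / 2) ^ n"
      using B(1) by simp
    then show ?thesis
      using B(2) that by fastforce
  qed
  then show ?rhs
    using B(1) by (intro exI[of _ B]) auto
next
  assume ?rhs
  then obtain L where L: "L \<ge> 0"
    "\<And>x y n. x \<in> Omega r \<Longrightarrow> y \<in> Omega r \<Longrightarrow> stake n x = stake n y \<Longrightarrow> \<bar>f x - f y\<bar> \<le> L * (1 / 2) ^ n"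
    by blast
  \<comment> \<open>The factor 2 makes up for the shift from \<open>(1 / 2) ^ n\<close> to the
    distance \<open>(1 / 2) ^ Suc n\<close>.\<close>
  have "\<bar>f x - f y\<bar> \<le> 2 * L * seq_dist x y" if "x \<in> Omega r" "y \<in> Omega r" for x y
  proof (cases "x = y")
    case False
    then obtain n where n: "seq_dist x y = (1 / 2) ^ Suc n"
      by (rule seq_dist_eq_pow)
    then have "stake n x = stake n y"
      by (simp only: stake_eq_iff_seq_dist)
    from L(2)[OF that this] show ?thesis
      unfolding n by simp
  qed (simp add: seq_dist_def)
  then show ?lhs
    by (auto simp: Lipschitz_continuous_map_def dist_real_def)
qed

lemma Lipschitz_Omega2I:
  fixes W :: "nat stream \<times> nat stream \<Rightarrow> real"
  assumes "\<And>x y x' y' n. x \<in> Omega r \<Longrightarrow> y \<in> Omega r \<Longrightarrow> x' \<in> Omega r \<Longrightarrow> y' \<in> Omega r \<Longrightarrow>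
    stake n x = stake n x' \<Longrightarrow> stake n y = stake n y' \<Longrightarrow> \<bar>W (x, y) - W (x', y')\<bar> \<le> L * (1 / 2) ^ n"
  shows "Lipschitz_continuous_map (max_metric (Omega_metric r) (Omega_metric r)) euclidean_metric W"
proof -
  have "\<bar>W (x, y) - W (x', y')\<bar> \<le> 2 * L * max (seq_dist x x') (seq_dist y y')"
    if "x \<in> Omega r" "y \<in> Omega r" "x' \<in> Omega r" "y' \<in> Omega r" for x y x' y'
  proof (cases "x = x' \<and> y = y'")
    case False
    then have "0 < max (seq_dist x x') (seq_dist y y')"
      by (auto simp: seq_dist_def less_max_iff_disj)
    \<comment> \<open>The maximum is itself one of the two distances, hence again a power of 1/2,
      and it bounds the disagreement in both coordinates at once.\<close>
    moreover obtain u v where uv: "max (seq_dist x x') (seq_dist y y') = seq_dist u v"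
      by (metis max_def)
    ultimately have "u \<noteq> v"
      by (auto simp: seq_dist_def)
    then obtain n where n: "max (seq_dist x x') (seq_dist y y') = (1 / 2) ^ Suc n"
      unfolding uv by (rule seq_dist_eq_pow)
    then have "stake n x = stake n x'" "stake n y = stake n y'"
      by (simp_all only: stake_eq_iff_seq_dist flip: n)
    from assms[OF that this] show ?thesis
      unfolding n by simp
  qed (simp add: seq_dist_def)
  then show ?thesis
    by (simp add: Lipschitz_continuous_map_def dist_real_def) blast
qed

lemma shd_in_Omega: "x \<in> Omega r \<Longrightarrow> shd x \<in> {1..r}"
  unfolding Omega_def by (rule streams_shd)

text \<open>With the first \<open>N\<close> terms gone, the series is dominated by a geometric tail
  starting at \<open>K * (1 / 2) ^ N\<close>, whose sum is twice its first term.\<close>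

lemma half_geometric_bound:
  fixes a :: "nat \<Rightarrow> real"
  assumes zero: "\<And>n. n < N \<Longrightarrow> a n = 0" and le: "\<And>n. N \<le> n \<Longrightarrow> \<bar>a n\<bar> \<le> K * (1 / 2) ^ n"
  shows "summable a" and "\<bar>suminf a\<bar> \<le> 2 * K * (1 / 2) ^ N"
proof -
  have g: "(\<lambda>n. K * (1 / 2) ^ N * (1 / 2) ^ n) sums (K * (1 / 2) ^ N * 2)"
    using geometric_sums[of "1 / 2 :: real"] by (intro sums_mult) simp
  have b: "norm (a (n + N)) \<le> K * (1 / 2) ^ N * (1 / 2) ^ n" for n
    using le[of "n + N"] by (simp add: power_add mult_ac)
  have s: "summable (\<lambda>n. a (n + N))"
    by (rule summable_comparison_test'[OF sums_summable[OF g] b])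
  then have sums: "a sums (\<Sum>n. a (n + N))"
    using sums_zero_iff_shift[of N a] zero summable_sums by blast
  then show "summable a"
    by (rule sums_summable)
  have "\<bar>suminf a\<bar> = norm (\<Sum>n. a (n + N))"
    using sums_unique[OF sums] by simp
  also have "\<dots> \<le> (\<Sum>n. K * (1 / 2) ^ N * (1 / 2) ^ n)"
    by (intro norm_suminf_le b sums_summable[OF g])
  also have "\<dots> = K * (1 / 2) ^ N * 2"
    by (rule sums_unique[OF g, symmetric])
  finally show "\<bar>suminf a\<bar> \<le> 2 * K * (1 / 2) ^ N"
    by (simp only: mult_ac)
qed

section \<open>Skew products that lose a symbol in the base and gain one in the fibre\<close>

locale skew_product =
  fixes r :: nat and T :: "nat stream \<Rightarrow> nat stream" and \<kappa> :: "nat \<Rightarrow> nat stream \<Rightarrow> nat stream"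
  assumes T_in: "x \<in> Omega r \<Longrightarrow> T x \<in> Omega r"
    and \<kappa>_in: "i \<in> {1..r} \<Longrightarrow> y \<in> Omega r \<Longrightarrow> \<kappa> i y \<in> Omega r"
    and T_expand: "x \<in> Omega r \<Longrightarrow> x' \<in> Omega r \<Longrightarrow> stake (Suc n) x = stake (Suc n) x' \<Longrightarrow>
      stake n (T x) = stake n (T x')"
    and \<kappa>_contract: "i \<in> {1..r} \<Longrightarrow> y \<in> Omega r \<Longrightarrow> y' \<in> Omega r \<Longrightarrow> stake n y = stake n y' \<Longrightarrow>
      stake (Suc n) (\<kappa> i y) = stake (Suc n) (\<kappa> i y')"
begin

text \<open>The second coordinate of the \<open>n\<close>-th iterate of the skew product at
  \<open>(x, y)\<close>. The first step is taken innermost, so a shift of the orbit by one is the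
  defining equation itself.\<close>

primrec fibre :: "nat \<Rightarrow> nat stream \<Rightarrow> nat stream \<Rightarrow> nat stream" where
  "fibre 0 x y = y"
| "fibre (Suc n) x y = fibre n (T x) (\<kappa> (shd x) y)"

text \<open>The sum starts at the first iterate, leaving out \<open>f y - f y0\<close>, because the
  identity sought evaluates \<open>f\<close> at \<open>\<kappa> (shd x) y\<close> and not at
  \<open>y\<close>.\<close>

definition transfer :: "(nat stream \<Rightarrow> real) \<Rightarrow> nat stream \<Rightarrow> nat stream \<Rightarrow> nat stream \<Rightarrow> real" where
  "transfer f y0 x y = (\<Sum>n. f (fibre (Suc n) x y) - f (fibre (Suc n) x y0))"

lemma \<kappa>_shd_in: "x \<in> Omega r \<Longrightarrow> y \<in> Omega r \<Longrightarrow> \<kappa> (shd x) y \<in> Omega r"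
  by (intro \<kappa>_in shd_in_Omega)

lemma fibre_in: "x \<in> Omega r \<Longrightarrow> y \<in> Omega r \<Longrightarrow> fibre n x y \<in> Omega r"
  by (induction n arbitrary: x y) (auto intro: T_in \<kappa>_shd_in)

text \<open>Both points are moved by the same maps, chosen by the orbit of \<open>x\<close>, and
  each of them adds one agreeing symbol.\<close>

lemma fibre_contract:
  assumes "x \<in> Omega r" "y \<in> Omega r" "y' \<in> Omega r" "stake m y = stake m y'"
  shows "stake (n + m) (fibre n x y) = stake (n + m) (fibre n x y')"
  using assms
proof (induction n arbitrary: m x y y')
  case (Suc n)
  have "shd x \<in> {1..r}"
    using Suc.prems(1) by (rule shd_in_Omega)
  then have "stake (Suc m) (\<kappa> (shd x) y) = stake (Suc m) (\<kappa> (shd x) y')"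
    using Suc.prems by (intro \<kappa>_contract)
  then have "stake (n + Suc m) (fibre n (T x) (\<kappa> (shd x) y)) =
      stake (n + Suc m) (fibre n (T x) (\<kappa> (shd x) y'))"
    using Suc.prems by (intro Suc.IH T_in \<kappa>_shd_in)
  then show ?case
    by (simp only: fibre.simps add_Suc_right add_Suc)
qed simp

text \<open>The base point enters only through the first symbols of its iterates under
  \<open>T\<close> before time \<open>n\<close>, and these are fixed by its first \<open>n\<close>
  symbols since \<open>T\<close> loses one symbol per step.\<close>

lemma fibre_cong:
  assumes "x \<in> Omega r" "x' \<in> Omega r" "stake n x = stake n x'"
  shows "fibre n x y = fibre n x' y"
  using assms
proof (induction n arbitrary: x x' y)
  case (Suc n)
  then have "fibre n (T x) z = fibre n (T x') z" for z
    by (intro Suc.IH T_in T_expand)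
  moreover have "shd x = shd x'"
    using Suc.prems by simp
  ultimately show ?case
    by simp
qed simp

section \<open>Regularity of the transfer function and its cohomological equation\<close>

context
  fixes f :: "nat stream \<Rightarrow> real" and L :: real
  assumes L: "0 \<le> L"
    "\<And>x y n. x \<in> Omega r \<Longrightarrow> y \<in> Omega r \<Longrightarrow> stake n x = stake n y \<Longrightarrow> \<bar>f x - f y\<bar> \<le> L * (1 / 2) ^ n"
begin

lemma fibre_diff_le:
  assumes "x \<in> Omega r" "y \<in> Omega r" "y' \<in> Omega r" "stake m y = stake m y'"
  shows "\<bar>f (fibre n x y) - f (fibre n x y')\<bar> \<le> L * (1 / 2) ^ m * (1 / 2) ^ n"
  using L(2)[OF fibre_in fibre_in fibre_contract] assms by (simp add: power_add mult_ac)

lemma fibre_Suc_diff_le: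
  assumes "x \<in> Omega r" "y \<in> Omega r" "y' \<in> Omega r" "stake m y = stake m y'"
  shows "\<bar>f (fibre (Suc n) x y) - f (fibre (Suc n) x y')\<bar> \<le> L / 2 * (1 / 2) ^ m * (1 / 2) ^ n"
  using fibre_diff_le[OF assms, of "Suc n"] by (simp del: fibre.simps)

lemma summable_transfer:
  assumes "x \<in> Omega r" "y \<in> Omega r" "y' \<in> Omega r"
  shows "summable (\<lambda>n. f (fibre (Suc n) x y) - f (fibre (Suc n) x y'))"
  using fibre_Suc_diff_le[OF assms, of 0]
  by (intro half_geometric_bound(1)[where N = 0 and K = "L / 2"]) (simp_all del: fibre.simps)

text \<open>One coordinate is changed at a time: replacing \<open>x\<close> by \<open>x'\<close>
  costs \<open>2 * L\<close>, replacing \<open>y\<close> by \<open>y'\<close> costs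
  \<open>L\<close>.\<close>

lemma transfer_Lipschitz:
  assumes in_Omega: "y0 \<in> Omega r" "x \<in> Omega r" "y \<in> Omega r" "x' \<in> Omega r" "y' \<in> Omega r"
    and x: "stake N x = stake N x'" and y: "stake N y = stake N y'"
  shows "\<bar>transfer f y0 x y - transfer f y0 x' y'\<bar> \<le> 3 * L * (1 / 2) ^ N"
proof -
  let ?d = "\<lambda>x y n. f (fibre (Suc n) x y) - f (fibre (Suc n) x y0)"
  have s: "summable (?d x y)" if "x \<in> Omega r" "y \<in> Omega r" for x y
    using that in_Omega by (intro summable_transfer)
  \<comment> \<open>Here \<open>Suc n \<le> N\<close>, so the common prefix of \<open>x\<close> and
    \<open>x'\<close> already determines the fibre points; only the tail contributes.\<close>
  have "?d x y n - ?d x' y n = 0" if "n < N" for n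
  proof -
    have "take (Suc n) (stake N x) = take (Suc n) (stake N x')"
      using x by simp
    then have "stake (Suc n) x = stake (Suc n) x'"
      using that by (simp only: take_stake min.absorb1 Suc_leI)
    then have "fibre (Suc n) x z = fibre (Suc n) x' z" for z
      by (intro fibre_cong in_Omega)
    then show ?thesis
      by (simp del: fibre.simps)
  qed
  moreover have "\<bar>?d x y n - ?d x' y n\<bar> \<le> L * (1 / 2) ^ n" for n
    using fibre_Suc_diff_le[OF \<open>x \<in> Omega r\<close> \<open>y \<in> Omega r\<close> \<open>y0 \<in> Omega r\<close>, of 0 n]
      fibre_Suc_diff_le[OF \<open>x' \<in> Omega r\<close> \<open>y \<in> Omega r\<close> \<open>y0 \<in> Omega r\<close>, of 0 n]
    unfolding stake.simps power_0 by argo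
  ultimately have "\<bar>\<Sum>n. ?d x y n - ?d x' y n\<bar> \<le> 2 * L * (1 / 2) ^ N"
    by (intro half_geometric_bound(2))
  then have 1: "\<bar>transfer f y0 x y - transfer f y0 x' y\<bar> \<le> 2 * L * (1 / 2) ^ N"
    using in_Omega by (simp only: transfer_def suminf_diff s)
  \<comment> \<open>The \<open>y0\<close> terms cancel. No initial terms need vanish now: every term
    carries the factor \<open>(1 / 2) ^ N\<close> from the agreement of \<open>y\<close> and
    \<open>y'\<close>.\<close>
  have "\<bar>\<Sum>n. ?d x' y n - ?d x' y' n\<bar> \<le> 2 * (L / 2 * (1 / 2) ^ N) * (1 / 2) ^ 0"
    using fibre_Suc_diff_le[OF \<open>x' \<in> Omega r\<close> \<open>y \<in> Omega r\<close> \<open>y' \<in> Omega r\<close> y]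
    by (intro half_geometric_bound(2)) (simp_all del: fibre.simps)
  then have "\<bar>transfer f y0 x' y - transfer f y0 x' y'\<bar> \<le> L * (1 / 2) ^ N"
    using in_Omega by (simp add: transfer_def suminf_diff s del: fibre.simps)
  with 1 show ?thesis
    by linarith
qed

text \<open>Over \<open>T x\<close>, the comparison of \<open>?z\<close> with \<open>y0\<close> is
  split at \<open>?w\<close>. The part from \<open>?z\<close> to \<open>?w\<close> is the series for
  \<open>(x, y)\<close> without its head \<open>f ?z - f ?w\<close>; the part from \<open>?w\<close>
  to \<open>y0\<close> depends on \<open>x\<close> alone.\<close>

lemma transfer_cohomologous:
  assumes "y0 \<in> Omega r" "x \<in> Omega r" "y \<in> Omega r"
  shows "f (\<kappa> (shd x) y0) + transfer f y0 (T x) (\<kappa> (shd x) y0) + transfer f y0 x y =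
    f (\<kappa> (shd x) y) + transfer f y0 (T x) (\<kappa> (shd x) y)"
proof -
  let ?z = "\<kappa> (shd x) y" and ?w = "\<kappa> (shd x) y0"
  define a where "a n = f (fibre n (T x) ?z) - f (fibre n (T x) ?w)" for n
  define b where "b n = f (fibre (Suc n) (T x) ?w) - f (fibre (Suc n) (T x) y0)" for n
  have in_Omega: "T x \<in> Omega r" "?z \<in> Omega r" "?w \<in> Omega r"
    using assms by (auto intro: T_in \<kappa>_shd_in)
  have a: "summable a"
    using summable_transfer[of x y y0] assms by (simp add: a_def[abs_def])
  have b: "summable b"
    using summable_transfer[of "T x" ?w y0] assms in_Omega
    by (simp add: b_def[abs_def] del: fibre.simps)
  have "transfer f y0 (T x) ?z = (\<Sum>n. a (Suc n) + b n)"
    by (simp add: transfer_def a_def b_def)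
  also have "\<dots> = (\<Sum>n. a (Suc n)) + suminf b"
    using a b by (intro suminf_add[symmetric]) (simp_all add: summable_Suc_iff)
  also have "\<dots> = suminf a - (f ?z - f ?w) + suminf b"
    using suminf_split_head[OF a] by (simp add: a_def)
  also have "suminf a = transfer f y0 x y"
    by (simp add: transfer_def a_def[abs_def])
  also have "suminf b = transfer f y0 (T x) ?w"
    by (simp add: transfer_def b_def[abs_def])
  finally show ?thesis
    by simp
qed

end

text \<open>The terms of the cohomological equation free of \<open>y\<close> are collected into
  \<open>g\<close>. The Lipschitz claim for exchanged coordinates serves the inverse map, whose base
  variable is the second argument of the final \<open>W\<close>.\<close>

lemma cohomologous_to_base_function:
  assumes f: "Lipschitz_continuous_map (Omega_metric r) euclidean_metric f" and r: "r \<ge> 1"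
  obtains g :: "nat stream \<Rightarrow> real" and W :: "nat stream \<times> nat stream \<Rightarrow> real" where
    "Lipschitz_continuous_map (Omega_metric r) euclidean_metric g"
    "Lipschitz_continuous_map (max_metric (Omega_metric r) (Omega_metric r)) euclidean_metric W"
    "Lipschitz_continuous_map (max_metric (Omega_metric r) (Omega_metric r)) euclidean_metric
      (\<lambda>(y, x). W (x, y))"
    "\<And>x y. x \<in> Omega r \<Longrightarrow> y \<in> Omega r \<Longrightarrow>
      g x + W (x, y) = f (\<kappa> (shd x) y) + W (T x, \<kappa> (shd x) y)"
proof -
  obtain L where L: "0 \<le> L"
    "\<And>x y n. x \<in> Omega r \<Longrightarrow> y \<in> Omega r \<Longrightarrow> stake n x = stake n y \<Longrightarrow> \<bar>f x - f y\<bar> \<le> L * (1 / 2) ^ n"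
    using f unfolding Lipschitz_Omega_iff by blast
  \<comment> \<open>Any reference point of \<open>Omega r\<close> would do; \<open>r \<ge> 1\<close>
    puts the symbol 1 in the alphabet.\<close>
  define y0 where "y0 = sconst (1 :: nat)"
  have y0: "y0 \<in> Omega r"
    using r by (simp add: y0_def Omega_def streams_iff_snth)
  define W where "W = (\<lambda>(x, y). transfer f y0 x y)"
  define g where "g x = f (\<kappa> (shd x) y0) + W (T x, \<kappa> (shd x) y0)" for x
  have W: "\<bar>W (x, y) - W (x', y')\<bar> \<le> 3 * L * (1 / 2) ^ n"
    if "x \<in> Omega r" "y \<in> Omega r" "x' \<in> Omega r" "y' \<in> Omega r"
      "stake n x = stake n x'" "stake n y = stake n y'" for x y x' y' n
    using transfer_Lipschitz[OF L y0 that] by (simp add: W_def)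
  \<comment> \<open>Losing a symbol under \<open>T\<close> doubles the constant \<open>3 * L\<close>
    of \<open>W\<close>. For \<open>n = 0\<close> the first symbols may differ, and the crude bound
    \<open>L + 3 * L\<close> suffices.\<close>
  have "\<bar>g x - g x'\<bar> \<le> 6 * L * (1 / 2) ^ n"
    if x: "x \<in> Omega r" "x' \<in> Omega r" and eq: "stake n x = stake n x'" for x x' n
  proof (cases n)
    case 0
    have "\<bar>f (\<kappa> (shd x) y0) - f (\<kappa> (shd x') y0)\<bar> \<le> L * (1 / 2) ^ 0"
      using x y0 by (intro L(2) \<kappa>_shd_in) simp_all
    moreover have "\<bar>W (T x, \<kappa> (shd x) y0) - W (T x', \<kappa> (shd x') y0)\<bar> \<le> 3 * L * (1 / 2) ^ 0"
      using x y0 by (intro W \<kappa>_shd_in T_in) simp_all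
    ultimately show ?thesis
      using L(1) 0 unfolding g_def by simp
  next
    case (Suc m)
    then have "shd x = shd x'"
      using eq by simp
    moreover have "\<bar>W (T x, \<kappa> (shd x) y0) - W (T x', \<kappa> (shd x) y0)\<bar> \<le> 3 * L * (1 / 2) ^ m"
      using x y0 eq Suc by (intro W \<kappa>_shd_in T_in T_expand) simp_all
    ultimately show ?thesis
      using Suc by (simp add: g_def)
  qed
  then have "Lipschitz_continuous_map (Omega_metric r) euclidean_metric g"
    unfolding Lipschitz_Omega_iff using L(1) by (intro exI[of _ "6 * L"]) auto
  moreover have "Lipschitz_continuous_map (max_metric (Omega_metric r) (Omega_metric r))
      euclidean_metric W"
    by (rule Lipschitz_Omega2I) (rule W)
  moreover have "Lipschitz_continuous_map (max_metric (Omega_metric r) (Omega_metric r))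
      euclidean_metric (\<lambda>(y, x). W (x, y))"
    by (rule Lipschitz_Omega2I[where L = "3 * L"]) (simp add: W)
  moreover have "g x + W (x, y) = f (\<kappa> (shd x) y) + W (T x, \<kappa> (shd x) y)"
    if "x \<in> Omega r" "y \<in> Omega r" for x y
    using transfer_cohomologous[OF L y0 that] by (simp add: g_def W_def)
  ultimately show ?thesis
    by (rule that)
qed

end

section \<open>The shift with \<open>tau\<close>, and \<open>Phi\<close> with prepending, as skew
  products\<close>

lemma
  assumes "\<forall>a\<in>{1..r}. bij_betw (\<phi> a) {1..r} {1..r}" "j \<in> {1..r}" "x \<in> Omega r"
  shows tau_in: "tau r \<phi> j x \<in> Omega r" and Phi_tau: "Phi \<phi> (tau r \<phi> j x) = x"
    and shd_tau: "shd (tau r \<phi> j x) = j"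
  using theI'[OF tau_ex1[OF assms]] by (simp_all add: tau_def)

lemma Phi_in:
  assumes "\<forall>a\<in>{1..r}. bij_betw (\<phi> a) {1..r} {1..r}" "x \<in> Omega r"
  shows "Phi \<phi> x \<in> Omega r"
proof -
  have "x !! n \<in> {1..r}" for n
    using assms(2) unfolding Omega_def by (rule snth_in)
  then show ?thesis
    using assms(1) bij_betwE unfolding Omega_def streams_iff_snth snth_Phi by blast
qed

text \<open>Injectivity of \<open>\<phi> a\<close> recovers each symbol from the preceding one and
  the image under \<open>Phi \<phi>\<close>. This is why \<open>tau\<close> gains a symbol.\<close>

lemma stake_Suc_eq_if_Phi_eq:
  assumes bij: "\<forall>a\<in>{1..r}. bij_betw (\<phi> a) {1..r} {1..r}"
    and "x \<in> Omega r" "y \<in> Omega r" and "shd x = shd y"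
    and "stake n (Phi \<phi> x) = stake n (Phi \<phi> y)"
  shows "stake (Suc n) x = stake (Suc n) y"
proof -
  have in_A: "x !! k \<in> {1..r}" "y !! k \<in> {1..r}" for k
    using assms(2,3) unfolding Omega_def by (blast intro: snth_in)+
  have "x !! k = y !! k" if "k < Suc n" for k
    using that
  proof (induction k)
    case 0
    then show ?case
      using assms(4) by simp
  next
    case (Suc k)
    then have "x !! k = y !! k" "\<phi> (x !! k) (x !! Suc k) = \<phi> (y !! k) (y !! Suc k)"
      using assms(5) unfolding stake_eq_iff_snth snth_Phi by auto
    moreover have "inj_on (\<phi> (x !! k)) {1..r}"
      using bij in_A bij_betw_imp_inj_on by blast
    ultimately show ?case
      using in_A by (metis inj_onD)
  qed
  then show ?thesis
    unfolding stake_eq_iff_snth by blast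
qed

lemma skew_product_tau:
  assumes bij: "\<forall>a\<in>{1..r}. bij_betw (\<phi> a) {1..r} {1..r}"
  shows "skew_product r stl (tau r \<phi>)"
proof
  show "stl x \<in> Omega r" if "x \<in> Omega r" for x
    using that by (simp add: Omega_def streams_stl)
  show "stake (Suc n) (tau r \<phi> i y) = stake (Suc n) (tau r \<phi> i y')"
    if "i \<in> {1..r}" "y \<in> Omega r" "y' \<in> Omega r" "stake n y = stake n y'" for i y y' n
    \<comment> \<open>The two preimages share the first symbol \<open>i\<close>, and
      \<open>Phi \<phi>\<close> maps them back to \<open>y\<close> and \<open>y'\<close>.\<close>
    using tau_in[OF bij] Phi_tau[OF bij] shd_tau[OF bij] that
    by (intro stake_Suc_eq_if_Phi_eq[OF bij]) metis+
  show "stake n (stl x) = stake n (stl x')" if "stake (Suc n) x = stake (Suc n) x'" for x x' n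
    using that by simp
  show "tau r \<phi> i y \<in> Omega r" if "i \<in> {1..r}" "y \<in> Omega r" for i y
    using bij that by (rule tau_in)
qed

lemma skew_product_Phi:
  assumes "\<forall>a\<in>{1..r}. bij_betw (\<phi> a) {1..r} {1..r}"
  shows "skew_product r (Phi \<phi>) SCons"
proof
  show "i ## y \<in> Omega r" if "i \<in> {1..r}" "y \<in> Omega r" for i y
    using that by (simp add: Omega_def)
  show "stake n (Phi \<phi> x) = stake n (Phi \<phi> x')"
    if "stake (Suc n) x = stake (Suc n) x'" for x x' n
    using that unfolding stake_eq_iff_snth snth_Phi by (simp del: snth.simps)
qed (use assms in \<open>simp_all add: Phi_in\<close>)

theorem proposition4p5:
  fixes r :: nat and \<phi> :: "nat \<Rightarrow> nat \<Rightarrow> nat"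
  assumes "r \<ge> 1"
    and "\<forall>a\<in>{1..r}. bij_betw (\<phi> a) {1..r} {1..r}"
  shows "(\<forall>A' :: nat stream \<Rightarrow> real.
           Lipschitz_continuous_map (Omega_metric r) euclidean_metric A' \<longrightarrow>
           (\<exists>(A :: nat stream \<Rightarrow> real) (W :: nat stream \<times> nat stream \<Rightarrow> real).
              Lipschitz_continuous_map (Omega_metric r) euclidean_metric A \<and>
              Lipschitz_continuous_map (max_metric (Omega_metric r) (Omega_metric r))
                euclidean_metric W \<and>
              (\<forall>i\<in>{1..r}. \<forall>x\<in>Omega r. \<forall>y\<in>Omega r.
                 A (i ## x) + W (i ## x, y) = A' (tau r \<phi> i y) + W (x, tau r \<phi> i y)))) \<and>
         (\<forall>A :: nat stream \<Rightarrow> real.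
           Lipschitz_continuous_map (Omega_metric r) euclidean_metric A \<longrightarrow>
           (\<exists>(A' :: nat stream \<Rightarrow> real) (W :: nat stream \<times> nat stream \<Rightarrow> real).
              Lipschitz_continuous_map (Omega_metric r) euclidean_metric A' \<and>
              Lipschitz_continuous_map (max_metric (Omega_metric r) (Omega_metric r))
                euclidean_metric W \<and>
              (\<forall>i\<in>{1..r}. \<forall>x\<in>Omega r. \<forall>y\<in>Omega r.
                 A (i ## x) + W (i ## x, y) = A' (tau r \<phi> i y) + W (x, tau r \<phi> i y))))"
proof (intro conjI allI impI)
  fix A' :: "nat stream \<Rightarrow> real"
  assume A': "Lipschitz_continuous_map (Omega_metric r) euclidean_metric A'"
  interpret skew_product r stl "tau r \<phi>"
    using assms(2) by (rule skew_product_tau)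
  obtain A W where AW: "Lipschitz_continuous_map (Omega_metric r) euclidean_metric A"
      "Lipschitz_continuous_map (max_metric (Omega_metric r) (Omega_metric r)) euclidean_metric W"
    and eq: "\<And>x y. x \<in> Omega r \<Longrightarrow> y \<in> Omega r \<Longrightarrow>
      A x + W (x, y) = A' (tau r \<phi> (shd x) y) + W (stl x, tau r \<phi> (shd x) y)"
    by (rule cohomologous_to_base_function[OF A' assms(1)]) blast
  have "A (i ## x) + W (i ## x, y) = A' (tau r \<phi> i y) + W (x, tau r \<phi> i y)"
    if "i \<in> {1..r}" "x \<in> Omega r" "y \<in> Omega r" for i x y
    using eq[of "i ## x" y] that by (simp add: Omega_def)
  with AW show "\<exists>A W. Lipschitz_continuous_map (Omega_metric r) euclidean_metric A \<and>
      Lipschitz_continuous_map (max_metric (Omega_metric r) (Omega_metric r)) euclidean_metric W \<and>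
      (\<forall>i\<in>{1..r}. \<forall>x\<in>Omega r. \<forall>y\<in>Omega r.
        A (i ## x) + W (i ## x, y) = A' (tau r \<phi> i y) + W (x, tau r \<phi> i y))"
    by blast
next
  fix A :: "nat stream \<Rightarrow> real"
  assume A: "Lipschitz_continuous_map (Omega_metric r) euclidean_metric A"
  interpret skew_product r "Phi \<phi>" SCons
    using assms(2) by (rule skew_product_Phi)
  \<comment> \<open>For the inverse map the base variable is \<open>z\<close>, so \<open>W\<close>
    arrives with its arguments exchanged.\<close>
  obtain A' W where A': "Lipschitz_continuous_map (Omega_metric r) euclidean_metric A'"
    and W: "Lipschitz_continuous_map (max_metric (Omega_metric r) (Omega_metric r))
      euclidean_metric (\<lambda>(x, z). W (z, x))"
    and eq: "\<And>z x. z \<in> Omega r \<Longrightarrow> x \<in> Omega r \<Longrightarrow>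
      A' z + W (z, x) = A (shd z ## x) + W (Phi \<phi> z, shd z ## x)"
    by (rule cohomologous_to_base_function[OF A assms(1)]) blast
  have "A (i ## x) + W (y, i ## x) = A' (tau r \<phi> i y) + W (tau r \<phi> i y, x)"
    if "i \<in> {1..r}" "x \<in> Omega r" "y \<in> Omega r" for i x y
    \<comment> \<open>At \<open>z = tau r \<phi> i y\<close> one has \<open>shd z = i\<close> and
      \<open>Phi \<phi> z = y\<close>, which turns the equation into the required one with its sides
      exchanged.\<close>
    using eq[of "tau r \<phi> i y" x] that assms(2) by (simp add: tau_in Phi_tau shd_tau)
  with A' W show "\<exists>A' W. Lipschitz_continuous_map (Omega_metric r) euclidean_metric A' \<and>
      Lipschitz_continuous_map (max_metric (Omega_metric r) (Omega_metric r)) euclidean_metric W \<and>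
      (\<forall>i\<in>{1..r}. \<forall>x\<in>Omega r. \<forall>y\<in>Omega r.
        A (i ## x) + W (i ## x, y) = A' (tau r \<phi> i y) + W (x, tau r \<phi> i y))"
    by (intro exI[of _ A'] exI[of _ "\<lambda>(x, z). W (z, x)"]) simp
qed

end
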